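(* Let $g>0$ and $\gamma_1,\gamma_2\in\mathbb{R}$. For $t\in\mathbb{R}$ and $0<\varepsilon<4/g$ let $$T(t)=\gamma_1+\gamma_2+gt,\quad \Delta(t)=\gamma_1-\gamma_2-gt,\quad R(t)=\sqrt{\Delta(t)^2+\tfrac{16}{g^2}},\quad y_\pm(t)=\frac{T(t)\pm R(t)}{2},$$ and let $$z_\pm^\varepsilon(t)=\frac{T(t)-i\varepsilon\pm R_\varepsilon(t)}{2},\qquad R_\varepsilon(t)=\sqrt{(\Delta(t)-i\varepsilon)^2+\tfrac{16}{g^2}},$$ where the branch of the square root is continued in $\varepsilon$ from $R_0(t)=R(t)>0$. Then, for each choice of sign, $$\sup_{t\in\mathbb{R}}|\mathrm{Re}\,z_\pm^\varepsilon(t)-y_\pm(t)|=\frac{g}{16}\,\varepsilon^2+O(\varepsilon^4)\qquad\text{as }\varepsilon\downarrow0.$$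
   Context: The numbers $z_\pm^\varepsilon(t)$ are the eigenvalues of the matrix $$\mathcal M_\varepsilon(t)=\begin{pmatrix}\gamma_1-i\varepsilon&-2i/g\\ 2i/g&\gamma_2+gt\end{pmatrix},$$ and $y_\pm(t)$ are the eigenvalues of the same matrix with $\varepsilon=0$; the functions $y_\pm$ solve the two-particle system $\ddot x_j=8(x_j-x_k)^{-3}$. *)

theory Defs
  imports "HOL-Analysis.Analysis" "HOL-Library.Landau_Symbols"
begin

definition T_fun :: "real \<Rightarrow> real \<Rightarrow> real \<Rightarrow> real \<Rightarrow> real" where
  "T_fun g \<gamma>1 \<gamma>2 t = \<gamma>1 + \<gamma>2 + g * t"

definition Delta :: "real \<Rightarrow> real \<Rightarrow> real \<Rightarrow> real \<Rightarrow> real" where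
  "Delta g \<gamma>1 \<gamma>2 t = \<gamma>1 - \<gamma>2 - g * t"

definition R_fun :: "real \<Rightarrow> real \<Rightarrow> real \<Rightarrow> real \<Rightarrow> real" where
  "R_fun g \<gamma>1 \<gamma>2 t = sqrt ((Delta g \<gamma>1 \<gamma>2 t)\<^sup>2 + 16 / g\<^sup>2)"

text \<open>The sign \<open>s\<close>, which is \<open>1\<close> or \<open>-1\<close>, selects the eigenvalue in \<open>y_pm\<close> and \<open>z_pm\<close>.\<close>

definition y_pm :: "real \<Rightarrow> real \<Rightarrow> real \<Rightarrow> real \<Rightarrow> real \<Rightarrow> real" where
  "y_pm s g \<gamma>1 \<gamma>2 t = (T_fun g \<gamma>1 \<gamma>2 t + s * R_fun g \<gamma>1 \<gamma>2 t) / 2"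

definition radicand :: "real \<Rightarrow> real \<Rightarrow> real \<Rightarrow> real \<Rightarrow> real \<Rightarrow> complex" where
  "radicand g \<gamma>1 \<gamma>2 \<epsilon> t =
     (complex_of_real (Delta g \<gamma>1 \<gamma>2 t) - \<i> * complex_of_real \<epsilon>)\<^sup>2 + complex_of_real (16 / g\<^sup>2)"

text \<open>\<open>Q \<epsilon> t\<close> plays the role of \<open>R\<^sub>\<epsilon>(t)\<close>: for each fixed \<open>t\<close> it is a square root of
  the radicand that is continued along \<open>0 \<le> \<epsilon> < 4/g\<close> from the positive root at \<open>\<epsilon> = 0\<close>.
  On that range the radicand has positive real part, so these conditions determine \<open>Q\<close>.\<close>

definition continued_root ::
    "real \<Rightarrow> real \<Rightarrow> real \<Rightarrow> (real \<Rightarrow> real \<Rightarrow> complex) \<Rightarrow> bool" where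
  "continued_root g \<gamma>1 \<gamma>2 Q \<longleftrightarrow>
     (\<forall>t. continuous_on {0..<4/g} (\<lambda>\<epsilon>. Q \<epsilon> t) \<and>
          Q 0 t = complex_of_real (R_fun g \<gamma>1 \<gamma>2 t) \<and>
          (\<forall>\<epsilon>\<in>{0..<4/g}. (Q \<epsilon> t)\<^sup>2 = radicand g \<gamma>1 \<gamma>2 \<epsilon> t))"

definition z_pm :: "(real \<Rightarrow> real \<Rightarrow> complex) \<Rightarrow> real \<Rightarrow> real \<Rightarrow> real \<Rightarrow> real \<Rightarrow> real \<Rightarrow> real \<Rightarrow> complex" where
  "z_pm Q s g \<gamma>1 \<gamma>2 \<epsilon> t =
     (complex_of_real (T_fun g \<gamma>1 \<gamma>2 t) - \<i> * complex_of_real \<epsilon> + complex_of_real s * Q \<epsilon> t) / 2"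

lemma continued_root_exists:
  assumes "g > 0"
  shows "\<exists>Q. continued_root g \<gamma>1 \<gamma>2 Q"
proof
  have pos: "Re (radicand g \<gamma>1 \<gamma>2 \<epsilon> t) > 0" if "\<epsilon> \<in> {0..<4/g}" for \<epsilon> t
  proof -
    have "\<epsilon>\<^sup>2 < (4/g)\<^sup>2"
      using that by (intro power_strict_mono) auto
    then have "\<epsilon>\<^sup>2 < 16 / g\<^sup>2"
      by (simp add: power_divide)
    moreover have "Re (radicand g \<gamma>1 \<gamma>2 \<epsilon> t) = (Delta g \<gamma>1 \<gamma>2 t)\<^sup>2 - \<epsilon>\<^sup>2 + 16 / g\<^sup>2"
      by (simp add: radicand_def power2_eq_square)
    ultimately show ?thesis
      using zero_le_power2[of "Delta g \<gamma>1 \<gamma>2 t"] by linarith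
  qed
  have "continuous_on {0..<4/g} (\<lambda>\<epsilon>. csqrt (radicand g \<gamma>1 \<gamma>2 \<epsilon> t))" for t
  proof -
    have csqrt: "continuous_on {w. Re w > 0} csqrt"
      by (intro continuous_at_imp_continuous_on ballI continuous_at_csqrt)
        (auto simp: complex_nonpos_Reals_iff)
    have rad: "continuous_on {0..<4/g} (\<lambda>\<epsilon>. radicand g \<gamma>1 \<gamma>2 \<epsilon> t)"
      unfolding radicand_def by (intro continuous_intros)
    show ?thesis
      by (rule continuous_on_compose2[OF csqrt rad]) (use pos in auto)
  qed
  moreover have "csqrt (radicand g \<gamma>1 \<gamma>2 0 t) = complex_of_real (R_fun g \<gamma>1 \<gamma>2 t)" for t
  proof -
    have "radicand g \<gamma>1 \<gamma>2 0 t = complex_of_real ((Delta g \<gamma>1 \<gamma>2 t)\<^sup>2 + 16 / g\<^sup>2)"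
      by (simp add: radicand_def)
    then show ?thesis
      unfolding R_fun_def by (metis of_real_sqrt add_nonneg_nonneg zero_le_power2 divide_nonneg_nonneg zero_le_numeral)
  qed
  ultimately show "continued_root g \<gamma>1 \<gamma>2 (\<lambda>\<epsilon> t. csqrt (radicand g \<gamma>1 \<gamma>2 \<epsilon> t))"
    unfolding continued_root_def by simp
qed

end

theory Submission imports Defs begin

text \<open>Write \<open>k = 4/g\<close>, \<open>d = \<Delta>(t)\<close> and \<open>R\<^sub>\<epsilon> = a + i b\<close>, so that
  \<open>a\<^sup>2 - b\<^sup>2 = d\<^sup>2 - \<epsilon>\<^sup>2 + k\<^sup>2\<close> and \<open>a b = - d \<epsilon>\<close>. The real part \<open>a\<close> never vanishes along the
  continuation, so it stays positive. The two equations force \<open>b\<^sup>2 \<le> \<epsilon>\<^sup>2\<close>, hence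
  \<open>0 \<le> (R - a) (R + a) = \<epsilon>\<^sup>2 - b\<^sup>2 \<le> \<epsilon>\<^sup>2\<close>, while \<open>R + a \<ge> k + sqrt (k\<^sup>2 - \<epsilon>\<^sup>2)\<close>. Thus
  \<open>\<bar>R - a\<bar>\<close> is maximal where \<open>d = 0\<close>, and the supremum is exactly \<open>(k - sqrt (k\<^sup>2 - \<epsilon>\<^sup>2)) / 2\<close>.\<close>

lemma sqrt_real_part_bounds:
  fixes a b d e k R :: real
  assumes a: "a > 0" and e: "0 \<le> e" "e < k"
    and re: "a\<^sup>2 - b\<^sup>2 = d\<^sup>2 - e\<^sup>2 + k\<^sup>2" and im: "a * b = - (d * e)"
    and R: "R \<ge> 0" "R\<^sup>2 = d\<^sup>2 + k\<^sup>2"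
  shows "0 \<le> R - a" "R - a \<le> k - sqrt (k\<^sup>2 - e\<^sup>2)"
proof -
  have im2: "a\<^sup>2 * b\<^sup>2 = d\<^sup>2 * e\<^sup>2"
    using im by (metis power2_minus power_mult_distrib)
  have b_le: "b\<^sup>2 \<le> e\<^sup>2"
  proof (rule ccontr)
    assume "\<not> b\<^sup>2 \<le> e\<^sup>2"
    then have less: "e\<^sup>2 < b\<^sup>2" by simp
    \<comment> \<open>The equation \<open>re\<close> reads
      \<open>a^2 = d^2 + k^2 + (b^2 - e^2)\<close>, so both factors of \<open>a^2 * b^2\<close>
      would exceed those of \<open>d^2 * e^2\<close>.\<close>
    then have "d\<^sup>2 < a\<^sup>2" using re zero_le_power2[of k] by linarith
    then have "d\<^sup>2 * e\<^sup>2 < a\<^sup>2 * b\<^sup>2"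
      using less by (intro mult_strict_mono) auto
    then show False using im2 by simp
  qed
  define r where "r = sqrt (k\<^sup>2 - e\<^sup>2)"
  have "e\<^sup>2 \<le> k\<^sup>2" using e by (intro power_mono) auto
  then have r: "r \<ge> 0" "r\<^sup>2 = k\<^sup>2 - e\<^sup>2" by (auto simp: r_def)
  \<comment> \<open>In fact \<open>a^2 = r^2 + d^2 + b^2\<close>.\<close>
  have "r\<^sup>2 \<le> a\<^sup>2" using re r zero_le_power2[of b] zero_le_power2[of d] by linarith
  then have "r \<le> a" using a by (simp add: power2_le_iff_abs_le)
  have "k\<^sup>2 \<le> R\<^sup>2" using R by simp
  then have "k \<le> R" using R(1) by (rule power2_le_imp_le)
  have "a\<^sup>2 \<le> R\<^sup>2" using re R b_le by linarith
  then show le: "0 \<le> R - a" using power2_le_imp_le[OF _ R(1)] by simp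
  \<comment> \<open>Replacing \<open>R + a\<close> by its lower bound \<open>k + r\<close> removes
    the dependence on \<open>d\<close>. The factor \<open>k + r\<close> is positive and also divides
    \<open>e^2\<close>, so it cancels at the end.\<close>
  have "(R - a) * (k + r) \<le> (R - a) * (R + a)"
    using le \<open>r \<le> a\<close> \<open>k \<le> R\<close> by (intro mult_left_mono) auto
  also have "\<dots> = e\<^sup>2 - b\<^sup>2"
    using re R by (simp add: algebra_simps power2_eq_square)
  also have "\<dots> \<le> e\<^sup>2" by simp
  also have "\<dots> = (k - r) * (k + r)"
    using r by (simp add: algebra_simps power2_eq_square)
  finally show "R - a \<le> k - sqrt (k\<^sup>2 - e\<^sup>2)"
    using e r(1) unfolding r_def[symmetric] by (simp add: mult_le_cancel_right)
qed

text \<open>With \<open>r = sqrt (k^2 - e^2)\<close> the error is exactly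
  \<open>(k - r)^2 / (4 * k)\<close>, and \<open>k - r = e^2 / (k + r)\<close> is at most
  \<open>e^2 / k\<close>. This gives an explicit constant for the remainder.\<close>

lemma sqrt_defect_expansion:
  fixes e k :: real
  assumes "0 \<le> e" "e < k"
  shows "\<bar>(k - sqrt (k\<^sup>2 - e\<^sup>2)) / 2 - e\<^sup>2 / (4 * k)\<bar> \<le> e ^ 4 / (4 * k ^ 3)"
proof -
  define r where "r = sqrt (k\<^sup>2 - e\<^sup>2)"
  have "k > 0" using assms by simp
  have "e\<^sup>2 \<le> k\<^sup>2" using assms by (intro power_mono) auto
  then have r: "r \<ge> 0" and e2: "e\<^sup>2 = (k - r) * (k + r)"
    by (auto simp: r_def algebra_simps simp flip: power2_eq_square)
  have "(k - r) / 2 - e\<^sup>2 / (4 * k) = (k - r)\<^sup>2 / (4 * k)"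
    using \<open>k > 0\<close> unfolding e2 by (simp add: field_simps power2_eq_square)
  moreover have "(k - r)\<^sup>2 / (4 * k) \<le> e ^ 4 / (4 * k ^ 3)"
  proof -
    have "(k - r)\<^sup>2 * k\<^sup>2 \<le> (k - r)\<^sup>2 * (k + r)\<^sup>2"
      using r \<open>k > 0\<close> by (intro mult_left_mono power_mono) auto
    also have "\<dots> = (e\<^sup>2)\<^sup>2" by (simp add: e2 power_mult_distrib)
    also have "\<dots> = e ^ 4" by simp
    finally have "(k - r)\<^sup>2 * k\<^sup>2 / (4 * k ^ 3) \<le> e ^ 4 / (4 * k ^ 3)"
      using \<open>k > 0\<close> by (intro divide_right_mono) auto
    then show ?thesis
      using \<open>k > 0\<close> by (simp add: power2_eq_square power3_eq_cube)
  qed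
  ultimately show ?thesis
    using \<open>k > 0\<close> by (simp add: r_def)
qed

text \<open>By continuity, the real part could lose its initial positivity only through a zero. At a
  zero the square of \<open>Q\<close> would have real part at most 0, whereas the radicand has
  positive real part.\<close>

lemma continued_root_Re_pos:
  assumes g: "g > 0" and Q: "continued_root g \<gamma>1 \<gamma>2 Q" and e: "\<epsilon> \<in> {0..<4/g}"
  shows "Re (Q \<epsilon> t) > 0"
proof (rule ccontr)
  assume "\<not> Re (Q \<epsilon> t) > 0"
  then have nonpos: "Re (Q \<epsilon> t) \<le> 0" by simp
  have "(Delta g \<gamma>1 \<gamma>2 t)\<^sup>2 + 16 / g\<^sup>2 > 0"
    using g by (intro add_nonneg_pos) auto
  then have start: "Re (Q 0 t) > 0"
    using Q by (simp add: continued_root_def R_fun_def)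
  have "continuous_on {0..<4/g} (\<lambda>\<epsilon>. Q \<epsilon> t)"
    using Q by (simp add: continued_root_def)
  then have "continuous_on {0..\<epsilon>} (\<lambda>\<epsilon>. Re (Q \<epsilon> t))"
    using e by (intro continuous_on_Re) (auto elim!: continuous_on_subset)
  then obtain x where x: "0 \<le> x" "x \<le> \<epsilon>" "Re (Q x t) = 0"
    using IVT2'[of "\<lambda>\<epsilon>. Re (Q \<epsilon> t)" \<epsilon> 0 0] nonpos start e by auto
  then have "(Q x t)\<^sup>2 = radicand g \<gamma>1 \<gamma>2 x t"
    using Q e by (auto simp: continued_root_def)
  then have "Re ((Q x t)\<^sup>2) = Re (radicand g \<gamma>1 \<gamma>2 x t)" by simp
  then have "- (Im (Q x t))\<^sup>2 = (Delta g \<gamma>1 \<gamma>2 t)\<^sup>2 - x\<^sup>2 + 16 / g\<^sup>2"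
    using x by (simp add: radicand_def power2_eq_square)
  moreover have "x\<^sup>2 < 16 / g\<^sup>2"
  proof -
    have "x\<^sup>2 < (4/g)\<^sup>2" using x e by (intro power_strict_mono) auto
    then show ?thesis by (simp add: power_divide)
  qed
  ultimately show False
    using zero_le_power2[of "Im (Q x t)"] zero_le_power2[of "Delta g \<gamma>1 \<gamma>2 t"] by linarith
qed

lemma continued_root_Re_bounds:
  assumes g: "g > 0" and Q: "continued_root g \<gamma>1 \<gamma>2 Q" and e: "\<epsilon> \<in> {0..<4/g}"
  shows "0 \<le> R_fun g \<gamma>1 \<gamma>2 t - Re (Q \<epsilon> t)"
    and "R_fun g \<gamma>1 \<gamma>2 t - Re (Q \<epsilon> t) \<le> 4/g - sqrt ((4/g)\<^sup>2 - \<epsilon>\<^sup>2)"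
    and "Delta g \<gamma>1 \<gamma>2 t = 0 \<Longrightarrow>
      R_fun g \<gamma>1 \<gamma>2 t - Re (Q \<epsilon> t) = 4/g - sqrt ((4/g)\<^sup>2 - \<epsilon>\<^sup>2)"
proof -
  let ?d = "Delta g \<gamma>1 \<gamma>2 t"
  have pos: "Re (Q \<epsilon> t) > 0" by (rule continued_root_Re_pos[OF assms])
  have sq: "(Q \<epsilon> t)\<^sup>2 = radicand g \<gamma>1 \<gamma>2 \<epsilon> t"
    using Q e by (simp add: continued_root_def)
  have re: "(Re (Q \<epsilon> t))\<^sup>2 - (Im (Q \<epsilon> t))\<^sup>2 = ?d\<^sup>2 - \<epsilon>\<^sup>2 + (4/g)\<^sup>2"
    using arg_cong[OF sq, of Re] by (simp add: radicand_def power2_eq_square)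
  have im: "Re (Q \<epsilon> t) * Im (Q \<epsilon> t) = - (?d * \<epsilon>)"
    using arg_cong[OF sq, of Im] by (simp add: radicand_def power2_eq_square mult.commute)
  have R: "R_fun g \<gamma>1 \<gamma>2 t \<ge> 0" "(R_fun g \<gamma>1 \<gamma>2 t)\<^sup>2 = ?d\<^sup>2 + (4/g)\<^sup>2"
    by (auto simp: R_fun_def power_divide)
  show "0 \<le> R_fun g \<gamma>1 \<gamma>2 t - Re (Q \<epsilon> t)"
    and "R_fun g \<gamma>1 \<gamma>2 t - Re (Q \<epsilon> t) \<le> 4/g - sqrt ((4/g)\<^sup>2 - \<epsilon>\<^sup>2)"
    using sqrt_real_part_bounds[OF pos _ _ re im R] e by auto
  show "R_fun g \<gamma>1 \<gamma>2 t - Re (Q \<epsilon> t) = 4/g - sqrt ((4/g)\<^sup>2 - \<epsilon>\<^sup>2)" if d: "?d = 0"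
  proof -
    have "R_fun g \<gamma>1 \<gamma>2 t = 4/g"
      using d R g by (simp add: power2_eq_iff_nonneg)
    moreover have "Im (Q \<epsilon> t) = 0" using im d pos by simp
    then have "(4/g)\<^sup>2 - \<epsilon>\<^sup>2 = (Re (Q \<epsilon> t))\<^sup>2" using re d by simp
    \<comment> \<open>Positivity of the real part selects this root rather than its
      negative.\<close>
    then have "sqrt ((4/g)\<^sup>2 - \<epsilon>\<^sup>2) = Re (Q \<epsilon> t)" using pos by simp
    ultimately show ?thesis by simp
  qed
qed

theorem mainTheorem4:
  fixes g \<gamma>1 \<gamma>2 s :: real and Q :: "real \<Rightarrow> real \<Rightarrow> complex"
  assumes "g > 0"
    and "continued_root g \<gamma>1 \<gamma>2 Q"
    and "s \<in> {1, -1}"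
  shows "(\<forall>\<epsilon>\<in>{0<..<4/g}. bdd_above (range (\<lambda>t. \<bar>Re (z_pm Q s g \<gamma>1 \<gamma>2 \<epsilon> t) - y_pm s g \<gamma>1 \<gamma>2 t\<bar>))) \<and>
         (\<lambda>\<epsilon>. (SUP t. \<bar>Re (z_pm Q s g \<gamma>1 \<gamma>2 \<epsilon> t) - y_pm s g \<gamma>1 \<gamma>2 t\<bar>) - g / 16 * \<epsilon>^2)
           \<in> O[at_right 0](\<lambda>\<epsilon>. \<epsilon>^4)"
proof -
  let ?F = "\<lambda>\<epsilon> t. \<bar>Re (z_pm Q s g \<gamma>1 \<gamma>2 \<epsilon> t) - y_pm s g \<gamma>1 \<gamma>2 t\<bar>"
  let ?M = "\<lambda>\<epsilon>. (4/g - sqrt ((4/g)\<^sup>2 - \<epsilon>\<^sup>2)) / 2"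
  have F: "?F \<epsilon> t = (R_fun g \<gamma>1 \<gamma>2 t - Re (Q \<epsilon> t)) / 2" if "\<epsilon> \<in> {0<..<4/g}" for \<epsilon> t
  proof -
    \<comment> \<open>The shift by \<open>- \<i> * \<epsilon>\<close> is purely imaginary and drops
      out. The sign \<open>s\<close> then disappears under the absolute value, so both eigenvalues
      give the same function.\<close>
    have "Re (z_pm Q s g \<gamma>1 \<gamma>2 \<epsilon> t) - y_pm s g \<gamma>1 \<gamma>2 t
        = s * (Re (Q \<epsilon> t) - R_fun g \<gamma>1 \<gamma>2 t) / 2"
      by (simp add: z_pm_def y_pm_def field_simps)
    then show ?thesis
      using assms(3) continued_root_Re_bounds(1)[OF assms(1,2), of \<epsilon> t] that by auto
  qed
  have le: "?F \<epsilon> t \<le> ?M \<epsilon>" if "\<epsilon> \<in> {0<..<4/g}" for \<epsilon> t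
    using continued_root_Re_bounds(2)[OF assms(1,2), of \<epsilon> t] that by (simp add: F)
  \<comment> \<open>This time is the zero of \<Delta>, where the uniform bound is attained.\<close>
  have "Delta g \<gamma>1 \<gamma>2 ((\<gamma>1 - \<gamma>2) / g) = 0"
    using assms(1) by (simp add: Delta_def)
  then have attained: "?F \<epsilon> ((\<gamma>1 - \<gamma>2) / g) = ?M \<epsilon>" if "\<epsilon> \<in> {0<..<4/g}" for \<epsilon>
    using continued_root_Re_bounds(3)[OF assms(1,2), of \<epsilon>] that by (simp add: F)
  have Sup: "(SUP t. ?F \<epsilon> t) = ?M \<epsilon>" if "\<epsilon> \<in> {0<..<4/g}" for \<epsilon>
  proof (rule cSup_eq_maximum)
    show "?M \<epsilon> \<in> range (?F \<epsilon>)"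
      by (rule range_eqI, rule attained[OF that, symmetric])
    show "\<And>x. x \<in> range (?F \<epsilon>) \<Longrightarrow> x \<le> ?M \<epsilon>"
      using le[OF that] by blast
  qed
  have "eventually (\<lambda>\<epsilon>. \<epsilon> \<in> {0<..<4/g}) (at_right 0)"
    using assms(1) by (intro eventually_at_right_real) auto
  \<comment> \<open>The expansion is used with \<open>k = 4/g\<close>: its main term
    \<open>\<epsilon>^2 / (4 * k)\<close> is \<open>g / 16 * \<epsilon>^2\<close>, and its error
    supplies the constant \<open>1 / (4 * k^3)\<close>.\<close>
  then have "eventually (\<lambda>\<epsilon>. norm ((SUP t. ?F \<epsilon> t) - g / 16 * \<epsilon>^2)
      \<le> 1 / (4 * (4/g) ^ 3) * norm (\<epsilon>^4)) (at_right 0)"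
  proof eventually_elim
    case (elim \<epsilon>)
    then show ?case
      using sqrt_defect_expansion[of \<epsilon> "4/g"] unfolding Sup[OF elim] by (simp add: mult.commute)
  qed
  then have "(\<lambda>\<epsilon>. (SUP t. ?F \<epsilon> t) - g / 16 * \<epsilon>^2) \<in> O[at_right 0](\<lambda>\<epsilon>. \<epsilon>^4)"
    by (rule bigoI)
  moreover have "\<forall>\<epsilon>\<in>{0<..<4/g}. bdd_above (range (?F \<epsilon>))"
    by (intro ballI bdd_aboveI2) (rule le)
  ultimately show ?thesis by blast
qed

end
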